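(* Let $k$ be a commutative ring with $\mathbb{Q}\subset k$, $\mathcal{A}$ an associative $k$-algebra, $M$ an $\mathcal{A}$-bimodule, $\phi:\mathcal{A}\otimes\mathcal{A}\to M$ a Hochschild 2-cocycle, and $\pi:M\to\mathcal{A}$ a $k$-linear map. Then $\pi$ is a $\phi$-Rota-Baxter operator if and only if $$\exp(X_{\pi})(\hat{\mu}+\hat{\phi})=\hat{\mu}+\hat{\phi}+[\hat{\mu}+\hat{\phi},\hat{\pi}]+\frac{1}{2}[[\hat{\phi},\hat{\pi}],\hat{\pi}].$$ In that case $\exp(X_{\pi})(\hat{\mu}+\hat{\phi})$ defines (by restriction to $M$) an associative multiplication on $M$, which has the form $$m\times n=\pi(m)\cdot n+m\cdot\pi(n)+\phi(\pi(m),\pi(n))\qquad(m,n\in M).$$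
   Context: Algebras are not necessarily unital. A Hochschild 2-cocycle $\phi\in C^2(\mathcal{A},M)$ is a $k$-bilinear map $\phi:\mathcal{A}\times\mathcal{A}\to M$ with $a\cdot\phi(b,c)-\phi(ab,c)+\phi(a,bc)-\phi(a,b)\cdot c=0$ for all $a,b,c\in\mathcal{A}$. A $k$-linear map $\pi:M\to\mathcal{A}$ is a $\phi$-Rota-Baxter operator if $\pi(m)\pi(n)=\pi(\pi(m)\cdot n+m\cdot\pi(n))+\pi(\phi(\pi(m),\pi(n)))$ for all $m,n\in M$. Lifts to $\mathcal{A}\oplus M$: $\hat{\pi}(a,m):=(\pi(m),0)$; $\hat{\mu}((a,m),(b,n)):=(ab,\,a\cdot n+m\cdot b)$; $\hat{\phi}((a,m),(b,n)):=(0,\phi(a,b))$. The module $M$ is identified with $0\oplus M\subset\mathcal{A}\oplus M$. Gerstenhaber bracket: for a $k$-module $B$ (here $B=\mathcal{A}\oplus M$) let $G(B):=\bigoplus_{n\ge1}\mathrm{Hom}_k(B^{\otimes n},B)$. For $f\in\mathrm{Hom}_k(B^{\otimes m},B)$ and $g\in\mathrm{Hom}_k(B^{\otimes n},B)$ set $f\bar{\circ}g:=\sum_{i=1}^m(-1)^{(i-1)(n-1)}f\circ_i g$, where $(f\circ_i g)(b_1,\dots,b_{m+n-1})=f(b_1,\dots,b_{i-1},g(b_i,\dots,b_{i+n-1}),b_{i+n},\dots,b_{m+n-1})$, and $[f,g]:=f\bar{\circ}g-(-1)^{(m-1)(n-1)}g\bar{\circ}f$. The Hamiltonian vector field of $\pi$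 is $X_\pi:=[\,\cdot\,,\hat{\pi}]$ on $G(\mathcal{A}\oplus M)$, and $\exp(X_\pi):=1+X_\pi+\frac{1}{2!}X_\pi^2+\frac{1}{3!}X_\pi^3+\cdots$; applied to any element of $G(\mathcal{A}\oplus M)$ this is a finite sum because $\hat{\pi}\circ\hat{\pi}=0$. *)

theory Defs
  imports "HOL-Library.Function_Algebras" "HOL-Analysis.Product_Vector"
begin

section \<open>Algebras, bimodules, cocycles, twisted Rota-Baxter operators\<close>

(* The inclusion of the rationals into k, as an injective unital ring homomorphism. *)
definition rat_inclusion :: "(rat \<Rightarrow> 'k::comm_ring_1) \<Rightarrow> bool" where
  "rat_inclusion \<iota> \<longleftrightarrow> inj \<iota> \<and> \<iota> 1 = 1 \<and>
     (\<forall>x y. \<iota> (x + y) = \<iota> x + \<iota> y) \<and> (\<forall>x y. \<iota> (x * y) = \<iota> x * \<iota> y)"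

definition bilinear_map ::
  "('k::comm_ring_1 \<Rightarrow> 'a::ab_group_add \<Rightarrow> 'a) \<Rightarrow> ('k \<Rightarrow> 'b::ab_group_add \<Rightarrow> 'b) \<Rightarrow>
   ('k \<Rightarrow> 'c::ab_group_add \<Rightarrow> 'c) \<Rightarrow> ('a \<Rightarrow> 'b \<Rightarrow> 'c) \<Rightarrow> bool" where
  "bilinear_map s1 s2 s3 f \<longleftrightarrow>
     (\<forall>x. module_hom s2 s3 (\<lambda>y. f x y)) \<and> (\<forall>y. module_hom s1 s3 (\<lambda>x. f x y))"

(* Associativity of the multiplication is part of the class ring, which does not ask for a unit. *)
locale assoc_algebra = module sA
  for sA :: "'k::comm_ring_1 \<Rightarrow> 'a::ring \<Rightarrow> 'a" +
  assumes mult_bilinear: "bilinear_map sA sA sA (*)"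

(* lact a m and ract m a are the left and right actions. *)
locale algebra_bimodule = assoc_algebra sA + M: module sM
  for sA :: "'k::comm_ring_1 \<Rightarrow> 'a::ring \<Rightarrow> 'a"
  and sM :: "'k \<Rightarrow> 'm::ab_group_add \<Rightarrow> 'm" +
  fixes lact :: "'a \<Rightarrow> 'm \<Rightarrow> 'm" and ract :: "'m \<Rightarrow> 'a \<Rightarrow> 'm"
  assumes lact_bilinear: "bilinear_map sA sM sM lact"
    and ract_bilinear: "bilinear_map sM sA sM ract"
    and lact_mult: "lact (a * b) m = lact a (lact b m)"
    and ract_mult: "ract m (a * b) = ract (ract m a) b"
    and lact_ract: "ract (lact a m) b = lact a (ract m b)"

definition hochschild_2_cocycle ::
  "('k::comm_ring_1 \<Rightarrow> 'a::ring \<Rightarrow> 'a) \<Rightarrow> ('k \<Rightarrow> 'm::ab_group_add \<Rightarrow> 'm) \<Rightarrow>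
   ('a \<Rightarrow> 'm \<Rightarrow> 'm) \<Rightarrow> ('m \<Rightarrow> 'a \<Rightarrow> 'm) \<Rightarrow> ('a \<Rightarrow> 'a \<Rightarrow> 'm) \<Rightarrow> bool" where
  "hochschild_2_cocycle sA sM lact ract \<phi> \<longleftrightarrow> bilinear_map sA sA sM \<phi> \<and>
     (\<forall>a b c. lact a (\<phi> b c) - \<phi> (a * b) c + \<phi> a (b * c) - ract (\<phi> a b) c = 0)"

definition phi_rota_baxter ::
  "('k::comm_ring_1 \<Rightarrow> 'a::ring \<Rightarrow> 'a) \<Rightarrow> ('k \<Rightarrow> 'm::ab_group_add \<Rightarrow> 'm) \<Rightarrow>
   ('a \<Rightarrow> 'm \<Rightarrow> 'm) \<Rightarrow> ('m \<Rightarrow> 'a \<Rightarrow> 'm) \<Rightarrow> ('a \<Rightarrow> 'a \<Rightarrow> 'm) \<Rightarrow> ('m \<Rightarrow> 'a) \<Rightarrow> bool" where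
  "phi_rota_baxter sA sM lact ract \<phi> \<pi> \<longleftrightarrow> module_hom sM sA \<pi> \<and>
     (\<forall>m n. \<pi> m * \<pi> n = \<pi> (lact (\<pi> m) n + ract m (\<pi> n)) + \<pi> (\<phi> (\<pi> m) (\<pi> n)))"


section \<open>The Gerstenhaber bracket\<close>

(*
  A k-linear map from the n-th tensor power of B to B is encoded as a k-multilinear function
  of n arguments, given as a list of length n; it is 0 on lists of any other length.
*)
definition Hom_tensor :: "('k::comm_ring_1 \<Rightarrow> 'b::ab_group_add \<Rightarrow> 'b) \<Rightarrow> nat \<Rightarrow> ('b list \<Rightarrow> 'b) set" where
  "Hom_tensor s n = {f. (\<forall>bs. length bs \<noteq> n \<longrightarrow> f bs = 0) \<and>
     (\<forall>bs i. length bs = n \<longrightarrow> i < n \<longrightarrow> module_hom s s (\<lambda>b. f (bs[i := b])))}"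

(*
  An element of G(B) is thus a single function on lists, whose component of arity n is its
  restriction to the lists of length n.  Addition is the pointwise one of Function_Algebras.
*)
definition component :: "nat \<Rightarrow> ('b list \<Rightarrow> 'b::zero) \<Rightarrow> 'b list \<Rightarrow> 'b" where
  "component n F = (\<lambda>bs. if length bs = n then F bs else 0)"

definition Gerst :: "('k::comm_ring_1 \<Rightarrow> 'b::ab_group_add \<Rightarrow> 'b) \<Rightarrow> ('b list \<Rightarrow> 'b) set" where
  "Gerst s = {F. F [] = 0 \<and> (\<forall>n\<ge>1. component n F \<in> Hom_tensor s n) \<and>
     finite {n. component n F \<noteq> 0}}"

definition signed :: "nat \<Rightarrow> 'b::ab_group_add \<Rightarrow> 'b" where
  "signed k b = (if even k then b else - b)"

(* m and n are the arities of f and g, and 1 \<le> i \<le> m. *)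
definition partial_comp :: "nat \<Rightarrow> nat \<Rightarrow> nat \<Rightarrow> ('b list \<Rightarrow> 'b) \<Rightarrow> ('b list \<Rightarrow> 'b) \<Rightarrow> 'b list \<Rightarrow> 'b::ab_group_add" where
  "partial_comp m n i f g = (\<lambda>bs. if length bs = m + n - 1
     then f (take (i - 1) bs @ [g (take n (drop (i - 1) bs))] @ drop (i - 1 + n) bs) else 0)"

definition circ_bar :: "nat \<Rightarrow> nat \<Rightarrow> ('b list \<Rightarrow> 'b) \<Rightarrow> ('b list \<Rightarrow> 'b) \<Rightarrow> 'b list \<Rightarrow> 'b::ab_group_add" where
  "circ_bar m n f g = (\<Sum>i = 1..m. signed ((i - 1) * (n - 1)) (partial_comp m n i f g))"

definition hom_bracket :: "nat \<Rightarrow> nat \<Rightarrow> ('b list \<Rightarrow> 'b) \<Rightarrow> ('b list \<Rightarrow> 'b) \<Rightarrow> 'b list \<Rightarrow> 'b::ab_group_add" where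
  "hom_bracket m n f g = circ_bar m n f g - signed ((m - 1) * (n - 1)) (circ_bar n m g f)"

(*
  Biadditive extension of hom_bracket: since [f,g] has arity m + n - 1, the component of
  arity N of [F,G] is the sum of the brackets of the components of F and G of arities
  m, n \<ge> 1 with m + n = N + 1.
*)
definition gbracket :: "('b list \<Rightarrow> 'b) \<Rightarrow> ('b list \<Rightarrow> 'b) \<Rightarrow> 'b list \<Rightarrow> 'b::ab_group_add" where
  "gbracket F G = (\<lambda>bs. \<Sum>m = 1..length bs.
     hom_bracket m (length bs + 1 - m) (component m F) (component (length bs + 1 - m) G) bs)"


section \<open>Lifts and the exponential of the Hamiltonian vector field\<close>

definition hat_pi :: "('m \<Rightarrow> 'a) \<Rightarrow> ('a::zero \<times> 'm::zero) list \<Rightarrow> 'a \<times> 'm" where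
  "hat_pi \<pi> bs = (case bs of [(a, m)] \<Rightarrow> (\<pi> m, 0) | _ \<Rightarrow> 0)"

definition hat_mu ::
  "('a \<Rightarrow> 'm \<Rightarrow> 'm) \<Rightarrow> ('m \<Rightarrow> 'a \<Rightarrow> 'm) \<Rightarrow> ('a::ring \<times> 'm::ab_group_add) list \<Rightarrow> 'a \<times> 'm" where
  "hat_mu lact ract bs = (case bs of [(a, m), (b, n)] \<Rightarrow> (a * b, lact a n + ract m b) | _ \<Rightarrow> 0)"

definition hat_phi :: "('a \<Rightarrow> 'a \<Rightarrow> 'm) \<Rightarrow> ('a::zero \<times> 'm::zero) list \<Rightarrow> 'a \<times> 'm" where
  "hat_phi \<phi> bs = (case bs of [(a, m), (b, n)] \<Rightarrow> (0, \<phi> a b) | _ \<Rightarrow> 0)"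

definition ham :: "('m \<Rightarrow> 'a) \<Rightarrow> (('a::ab_group_add \<times> 'm::ab_group_add) list \<Rightarrow> 'a \<times> 'm) \<Rightarrow>
   ('a \<times> 'm) list \<Rightarrow> 'a \<times> 'm" where
  "ham \<pi> F = gbracket F (hat_pi \<pi>)"

definition scale_fun :: "('k \<Rightarrow> 'b \<Rightarrow> 'b) \<Rightarrow> 'k \<Rightarrow> ('b list \<Rightarrow> 'b) \<Rightarrow> 'b list \<Rightarrow> 'b" where
  "scale_fun s c F = (\<lambda>bs. s c (F bs))"

(*
  The sum runs over the nonzero iterates only; there are finitely many of them on G(B)
  by finite_ham_powers below.  s is the scalar multiplication of B.
*)
definition exp_ham :: "(rat \<Rightarrow> 'k) \<Rightarrow> ('k \<Rightarrow> 'a \<times> 'm \<Rightarrow> 'a \<times> 'm) \<Rightarrow> ('m \<Rightarrow> 'a) \<Rightarrow>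
   (('a::ab_group_add \<times> 'm::ab_group_add) list \<Rightarrow> 'a \<times> 'm) \<Rightarrow> ('a \<times> 'm) list \<Rightarrow> 'a \<times> 'm" where
  "exp_ham \<iota> s \<pi> F =
     (\<Sum>n | (ham \<pi> ^^ n) F \<noteq> 0. scale_fun s (\<iota> (1 / fact n)) ((ham \<pi> ^^ n) F))"

(* The M-component of the product of elements of M, identified with 0 \<oplus> M. *)
definition restrict_M :: "(('a::zero \<times> 'm) list \<Rightarrow> 'a \<times> 'm) \<Rightarrow> 'm \<Rightarrow> 'm \<Rightarrow> 'm" where
  "restrict_M E m n = snd (E [(0, m), (0, n)])"

definition restricts_to_assoc_mult ::
  "('k::comm_ring_1 \<Rightarrow> 'a::ab_group_add \<Rightarrow> 'a) \<Rightarrow> ('k \<Rightarrow> 'm::ab_group_add \<Rightarrow> 'm) \<Rightarrow>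
   (('a \<times> 'm) list \<Rightarrow> 'a \<times> 'm) \<Rightarrow> bool" where
  "restricts_to_assoc_mult sA sM E \<longleftrightarrow>
     E \<in> Hom_tensor (module_prod.scale sA sM) 2 \<and>
     (\<forall>m n. E [(0, m), (0, n)] \<in> {0} \<times> UNIV) \<and>
     bilinear_map sM sM sM (restrict_M E) \<and>
     (\<forall>m n p. restrict_M E (restrict_M E m n) p = restrict_M E m (restrict_M E n p))"


section \<open>Well-definedness\<close>

definition null_on_zero :: "('b list \<Rightarrow> 'b::ab_group_add) \<Rightarrow> bool" where
  "null_on_zero F \<longleftrightarrow> F [] = 0 \<and> (\<forall>bs. 0 \<in> set bs \<longrightarrow> F bs = 0)"

lemma Hom_tensor_null:
  assumes "f \<in> Hom_tensor s n" "n \<ge> 1"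
  shows "null_on_zero f"
proof -
  have "f bs = 0" if "0 \<in> set bs" for bs
  proof (cases "length bs = n")
    case True
    from that obtain i where i: "i < length bs" "bs ! i = 0"
      by (auto simp: in_set_conv_nth)
    have "module_hom s s (\<lambda>b. f (bs[i := b]))"
      using assms i True by (auto simp: Hom_tensor_def)
    from module_hom.zero[OF this] show ?thesis
      using i by (metis list_update_id)
  qed (use assms in \<open>auto simp: Hom_tensor_def\<close>)
  moreover have "f [] = 0" using assms by (auto simp: Hom_tensor_def)
  ultimately show ?thesis by (auto simp: null_on_zero_def)
qed

lemma Gerst_null:
  assumes "F \<in> Gerst s"
  shows "null_on_zero F"
proof -
  have "F bs = 0" if "0 \<in> set bs" for bs
  proof -
    have 1: "length bs \<ge> 1" using that by (cases bs) auto
    then have "component (length bs) F \<in> Hom_tensor s (length bs)"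
      using assms by (auto simp: Gerst_def)
    from Hom_tensor_null[OF this 1] that have "component (length bs) F bs = 0"
      by (auto simp: null_on_zero_def)
    then show ?thesis by (simp add: component_def)
  qed
  with assms show ?thesis by (auto simp: null_on_zero_def Gerst_def)
qed

lemma signed_0 [simp]: "signed k 0 = 0"
  by (simp add: signed_def)

lemma signed_apply: "signed k f x = signed k (f x)"
  by (simp add: signed_def)

lemma sum_fun_apply: "(\<Sum>i\<in>I. f i) x = (\<Sum>i\<in>I. f i x)"
  by (induction I rule: infinite_finite_induct) auto

lemma circ_bar_0_left: "circ_bar m n 0 g = 0"
  by (rule ext) (simp add: circ_bar_def partial_comp_def sum_fun_apply signed_apply zero_fun_def)

lemma circ_bar_0_right:
  assumes "null_on_zero f"
  shows "circ_bar m n f 0 = 0"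
proof -
  have "partial_comp m n i f 0 = 0" for i
    using assms by (auto simp: partial_comp_def null_on_zero_def zero_fun_def)
  then show ?thesis by (simp add: circ_bar_def)
qed

lemma null_on_zero_component: "null_on_zero F \<Longrightarrow> null_on_zero (component n F)"
  by (auto simp: null_on_zero_def component_def)

lemma hom_bracket_0:
  assumes "null_on_zero f" "null_on_zero g" "f = 0 \<or> g = 0"
  shows "hom_bracket m n f g = 0"
  using assms by (auto simp: hom_bracket_def circ_bar_0_left circ_bar_0_right)

lemma gbracket_homogeneous:
  fixes f g :: "'b list \<Rightarrow> 'b::ab_group_add"
  assumes f: "f \<in> Hom_tensor s m" and g: "g \<in> Hom_tensor s n" and mn: "m \<ge> 1" "n \<ge> 1"
  shows "gbracket f g = hom_bracket m n f g"
proof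
  fix bs :: "'b list"
  have cf: "component k f = (if k = m then f else 0)" for k
    using f by (auto simp: component_def Hom_tensor_def fun_eq_iff)
  have cg: "component k g = (if k = n then g else 0)" for k
    using g by (auto simp: component_def Hom_tensor_def fun_eq_iff)
  have nf: "null_on_zero f" "null_on_zero g" "null_on_zero (0 :: 'b list \<Rightarrow> 'b)"
    using Hom_tensor_null f g mn by (auto simp: null_on_zero_def)
  let ?N = "length bs"
  let ?t = "\<lambda>k. hom_bracket k (?N + 1 - k) (component k f) (component (?N + 1 - k) g) bs"
  have t0: "?t k = 0" if "k \<noteq> m \<or> ?N + 1 - k \<noteq> n" for k
    using that nf by (auto simp: cf cg hom_bracket_0)
  show "gbracket f g bs = hom_bracket m n f g bs"
  proof (cases "?N = m + n - 1")
    case True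
    have "?t k = (if k = m then ?t m else 0)" for k
      using t0[of k] by (cases "k = m") auto
    then have "gbracket f g bs = (\<Sum>k = 1..?N. if k = m then ?t m else 0)"
      unfolding gbracket_def by (intro sum.cong refl)
    also have "m \<in> {1..?N}" using True mn by auto
    then have "(\<Sum>k = 1..?N. if k = m then ?t m else 0) = ?t m" by simp
    also have "\<dots> = hom_bracket m n f g bs" using True mn by (simp add: cf cg)
    finally show ?thesis .
  next
    case False
    have "gbracket f g bs = 0"
      unfolding gbracket_def using False mn by (intro sum.neutral ballI t0) auto
    moreover have "hom_bracket m n f g bs = 0"
      using False by (auto simp: hom_bracket_def circ_bar_def partial_comp_def sum_fun_apply
          signed_apply add.commute)
    ultimately show ?thesis by simp
  qed
qed

definition pi_deriv :: "('b \<Rightarrow> 'b) \<Rightarrow> ('b list \<Rightarrow> 'b) \<Rightarrow> 'b list \<Rightarrow> 'b::ab_group_add" where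
  "pi_deriv P F bs = (\<Sum>i<length bs. F (bs[i := P (bs ! i)])) - P (F bs)"

lemma gbracket_unary:
  assumes F: "null_on_zero F" and P0: "P 0 = 0"
    and p: "\<And>b. p [b] = P b" "\<And>bs. length bs \<noteq> 1 \<Longrightarrow> p bs = 0"
  shows "gbracket F p = pi_deriv P F"
proof
  fix bs :: "'a list"
  let ?N = "length bs"
  have cp: "component k p = (if k = 1 then p else 0)" for k
    using p(2) by (auto simp: component_def fun_eq_iff)
  have np: "null_on_zero p"
    unfolding null_on_zero_def
  proof (intro conjI allI impI)
    fix bs :: "'a list" assume "0 \<in> set bs"
    then show "p bs = 0"
      by (cases "length bs = 1") (auto simp: p P0 length_Suc_conv)
  qed (simp add: p)
  have nf: "null_on_zero (component k F)" "null_on_zero (component k p)" for k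
    using F np by (auto intro: null_on_zero_component)
  let ?t = "\<lambda>k. hom_bracket k (?N + 1 - k) (component k F) (component (?N + 1 - k) p) bs"
  have t0: "?t k = 0" if "?N + 1 - k \<noteq> 1" for k
    using that hom_bracket_0[OF nf, of k "?N + 1 - k"] by (simp add: cp)
  show "gbracket F p bs = pi_deriv P F bs"
  proof (cases "bs = []")
    case True
    then show ?thesis using F P0 by (simp add: gbracket_def pi_deriv_def null_on_zero_def)
  next
    case False
    then have N: "?N \<ge> 1" by (cases bs) auto
    have "?t k = (if k = ?N then ?t ?N else 0)" if "k \<in> {1..?N}" for k
      using t0[of k] that by (cases "k = ?N") auto
    then have "gbracket F p bs = (\<Sum>k = 1..?N. if k = ?N then ?t ?N else 0)"
      unfolding gbracket_def by (intro sum.cong refl)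
    also have "\<dots> = hom_bracket ?N 1 (component ?N F) p bs"
      using N by (simp add: cp)
    also have "\<dots> = (\<Sum>i = 1..?N. partial_comp ?N 1 i (component ?N F) p bs)
        - partial_comp 1 ?N 1 p (component ?N F) bs"
      by (simp add: hom_bracket_def circ_bar_def sum_fun_apply signed_def)
    also have "partial_comp 1 ?N 1 p (component ?N F) bs = P (F bs)"
      by (simp add: partial_comp_def component_def p)
    also have "(\<Sum>i = 1..?N. partial_comp ?N 1 i (component ?N F) p bs)
        = (\<Sum>i<?N. partial_comp ?N 1 (Suc i) (component ?N F) p bs)"
      by (simp only: One_nat_def sum.atLeast1_atMost_eq)
    also have "\<dots> = (\<Sum>i<?N. F (bs[i := P (bs ! i)]))"
    proof (rule sum.cong)
      fix i assume "i \<in> {..<?N}"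
      then have i: "i < ?N" by simp
      have "take 1 (drop i bs) = [bs ! i]"
        using i by (simp add: take_Suc_conv_app_nth)
      then show "partial_comp ?N 1 (Suc i) (component ?N F) p bs = F (bs[i := P (bs ! i)])"
        using i N by (auto simp: partial_comp_def component_def p upd_conv_take_nth_drop)
    qed simp
    finally show ?thesis by (simp add: pi_deriv_def)
  qed
qed

lemma null_on_zero_pi_deriv:
  assumes F: "null_on_zero F" and P0: "P 0 = 0"
  shows "null_on_zero (pi_deriv P F)"
  unfolding null_on_zero_def
proof (intro conjI allI impI)
  show "pi_deriv P F [] = 0" using assms by (simp add: pi_deriv_def null_on_zero_def)
next
  fix bs :: "'a list" assume z: "0 \<in> set bs"
  have "0 \<in> set (bs[i := P (bs ! i)])" if "i < length bs" for i
  proof -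
    obtain j where j: "j < length bs" "bs ! j = 0" using z by (auto simp: in_set_conv_nth)
    then have "bs[i := P (bs ! i)] ! j = 0" using that P0 by (simp add: nth_list_update)
    then show ?thesis using j by (metis length_list_update nth_mem)
  qed
  with z F P0 show "pi_deriv P F bs = 0"
    by (simp add: pi_deriv_def null_on_zero_def)
qed

lemma gbracket_powers:
  assumes F: "null_on_zero F" and P0: "P 0 = 0"
    and p: "\<And>b. p [b] = P b" "\<And>bs. length bs \<noteq> 1 \<Longrightarrow> p bs = 0"
  shows "((\<lambda>F. gbracket F p) ^^ n) F = (pi_deriv P ^^ n) F \<and> null_on_zero ((pi_deriv P ^^ n) F)"
proof (induction n)
  case (Suc n)
  let ?F = "(pi_deriv P ^^ n) F"
  have n: "null_on_zero ?F" using Suc by blast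
  have "gbracket ?F p = pi_deriv P ?F" by (rule gbracket_unary) (use n P0 p in auto)
  moreover have "null_on_zero (pi_deriv P ?F)" by (rule null_on_zero_pi_deriv) (use n P0 in auto)
  ultimately show ?case using Suc by simp
qed (use F in simp)

(*
  Each application of pi_deriv inserts P into one more argument or into the value, and
  inserting it twice at the same place gives 0.
*)
lemma pi_deriv_nilpotent:
  fixes F :: "'b list \<Rightarrow> 'b::ab_group_add"
  assumes F: "null_on_zero F" and P0: "P 0 = 0" and Padd: "\<And>x y. P (x + y) = P x + P y"
    and PP: "\<And>b. P (P b) = 0" and n: "n \<ge> length bs + 2"
  shows "(pi_deriv P ^^ n) F bs = 0"
proof -
  have Psum: "P (\<Sum>i\<in>I. f i) = (\<Sum>i\<in>I. P (f i))" for I :: "nat set" and f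
    by (induction I rule: infinite_finite_induct) (auto simp: P0 Padd)
  have Pdiff: "P (x - y) = P x - P y" for x y
    by (metis Padd add_diff_cancel_right' diff_add_cancel)
  have nz: "null_on_zero ((pi_deriv P ^^ k) F)" for k
    by (induction k) (auto simp: F P0 null_on_zero_pi_deriv)
  define r where "r bs = card {i. i < length bs \<and> bs ! i \<in> range P}" for bs :: "'b list"
  have r_le: "r bs \<le> length bs" for bs
  proof -
    have "r bs \<le> card {..<length bs}" unfolding r_def by (rule card_mono) auto
    then show ?thesis by simp
  qed
  have key: "(r bs + 0 + k \<ge> length bs + 2 \<longrightarrow> (pi_deriv P ^^ k) F bs = 0) \<and>
             (r bs + 1 + k \<ge> length bs + 2 \<longrightarrow> P ((pi_deriv P ^^ k) F bs) = 0)" for k bs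
  proof (induction k arbitrary: bs)
    case 0
    then show ?case using r_le[of bs] by auto
  next
    case (Suc k)
    let ?F = "(pi_deriv P ^^ k) F"
    have arg: "?F (bs[i := P (bs ! i)]) = 0 \<or>
        r (bs[i := P (bs ! i)]) = Suc (r bs)" if i: "i < length bs" for i
    proof (cases "bs ! i \<in> range P")
      case True
      then have "0 \<in> set (bs[i := P (bs ! i)])"
        using i PP by (auto simp: set_update_memI)
      then show ?thesis using nz[of k] by (auto simp: null_on_zero_def)
    next
      case False
      have "{j. j < length (bs[i := P (bs ! i)]) \<and> bs[i := P (bs ! i)] ! j \<in> range P}
          = insert i {j. j < length bs \<and> bs ! j \<in> range P}"
        using i by (auto simp: nth_list_update)
      then show ?thesis using False by (simp add: r_def)
    qed
    have a0: "?F (bs[i := P (bs ! i)]) = 0"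
      if "i < length bs" "r bs + Suc k \<ge> length bs + 2" for i
      using arg[OF that(1)] Suc.IH[of "bs[i := P (bs ! i)]"] that by auto
    have a1: "P (?F (bs[i := P (bs ! i)])) = 0"
      if "i < length bs" "r bs + 1 + Suc k \<ge> length bs + 2" for i
      using arg[OF that(1)] Suc.IH[of "bs[i := P (bs ! i)]"] that P0 by auto
    show ?case
    proof (intro conjI impI)
      assume h: "r bs + 0 + Suc k \<ge> length bs + 2"
      have "P (?F bs) = 0" using Suc.IH[of bs] h by auto
      then show "(pi_deriv P ^^ Suc k) F bs = 0"
        using a0 h by (simp add: pi_deriv_def)
    next
      assume h: "r bs + 1 + Suc k \<ge> length bs + 2"
      then show "P ((pi_deriv P ^^ Suc k) F bs) = 0"
        using a1[OF _ h] by (simp add: pi_deriv_def Pdiff Psum PP)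
    qed
  qed
  show ?thesis using key[of bs n] n by auto
qed

lemma pi_deriv_component_0:
  fixes F :: "'b list \<Rightarrow> 'b::ab_group_add"
  assumes "component N F = 0" "P 0 = 0" "length bs = N"
  shows "(pi_deriv P ^^ k) F bs = 0"
  using assms(3)
proof (induction k arbitrary: bs)
  case 0
  then show ?case using fun_cong[OF assms(1), of bs] by (simp add: component_def)
next
  case (Suc k)
  then show ?case by (simp add: pi_deriv_def assms(2))
qed

(* exp_ham is a finite sum on all of G(A \<oplus> M). *)
lemma finite_ham_powers:
  assumes F: "F \<in> Gerst s" and \<pi>: "module_hom sM sA \<pi>"
  shows "finite {n. (ham \<pi> ^^ n) F \<noteq> 0}"
proof -
  define P :: "'a \<times> 'b \<Rightarrow> 'a \<times> 'b" where "P = (\<lambda>(a, m). (\<pi> m, 0))"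
  have \<pi>0: "\<pi> 0 = 0" and \<pi>add: "\<And>x y. \<pi> (x + y) = \<pi> x + \<pi> y"
    using module_hom.zero[OF \<pi>] module_hom.add[OF \<pi>] by auto
  have P0: "P 0 = 0" and PP: "\<And>b. P (P b) = 0" and Padd: "\<And>x y. P (x + y) = P x + P y"
    by (auto simp: P_def \<pi>0 \<pi>add zero_prod_def split: prod.splits)
  have p: "hat_pi \<pi> [b] = P b" for b by (cases b) (simp add: hat_pi_def P_def)
  have p': "hat_pi \<pi> bs = 0" if "length bs \<noteq> 1" for bs :: "('a \<times> 'b) list"
    using that by (auto simp: hat_pi_def split: list.splits)
  have ham: "ham \<pi> = (\<lambda>F. gbracket F (hat_pi \<pi>))" by (rule ext) (simp add: ham_def)
  have nF: "null_on_zero F" by (rule Gerst_null[OF F])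
  have pw: "(ham \<pi> ^^ n) F = (pi_deriv P ^^ n) F" for n
    unfolding ham using gbracket_powers[of F P "hat_pi \<pi>" n, OF nF P0 p p'] by blast
  have "finite {n. component n F \<noteq> 0}" using F by (simp add: Gerst_def)
  then obtain K where K: "\<And>n. component n F \<noteq> 0 \<Longrightarrow> n \<le> K"
    by (auto simp: finite_nat_set_iff_bounded_le)
  have "(ham \<pi> ^^ n) F = 0" if n: "n \<ge> K + 2" for n
  proof
    fix bs
    show "(ham \<pi> ^^ n) F bs = 0 bs"
    proof (cases "component (length bs) F = 0")
      case True
      then show ?thesis unfolding pw using pi_deriv_component_0[of "length bs" F P bs n] P0 by simp
    next
      case False
      then show ?thesis
        unfolding pw using pi_deriv_nilpotent[of F P bs n, OF nF P0 Padd PP] K[OF False] n by simp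
    qed
  qed
  then have "{n. (ham \<pi> ^^ n) F \<noteq> 0} \<subseteq> {..<K + 2}" by (auto simp: not_less[symmetric])
  then show ?thesis using finite_subset by blast
qed

end

theory Submission
  imports Defs
begin

text \<open>
  On biadditive operations, \<open>exp X\<^sub>\<pi>\<close> is conjugation by the automorphism \<open>1 + P\<close>
  of the sum of the algebra and the bimodule, where \<open>P (a, m) = (\<pi> m, 0)\<close> satisfies
  \<open>P \<circ> P = 0\<close>: it sends \<open>f\<close> to \<open>(x, y) \<mapsto> (1 - P) f ((1 + P) x, (1 + P) y)\<close>.
  The difference of the two sides of the claimed formula at \<open>((a, m), (b, n))\<close> is then
  the Rota-Baxter defect of \<open>\<pi>\<close> at \<open>(m, n)\<close>, and on the bimodule the conjugated operation
  is visible at once.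
\<close>

section \<open>Operations of arity two\<close>

text \<open>All operations that occur have arity two, and a bracket with a unary map keeps this
  arity. The calculation can therefore leave lists for functions of two arguments.\<close>

definition binary :: "('b \<Rightarrow> 'b \<Rightarrow> 'b) \<Rightarrow> 'b list \<Rightarrow> 'b::zero" where
  "binary f bs = (case bs of [x, y] \<Rightarrow> f x y | _ \<Rightarrow> 0)"

lemma binary_pair [simp]: "binary f [x, y] = f x y"
  by (simp add: binary_def)

lemma binary_other: "length bs \<noteq> 2 \<Longrightarrow> binary f bs = 0"
  by (auto simp: binary_def split: list.splits)

lemma binary_eqI:
  assumes "\<And>x y. F [x, y] = f x y" and "\<And>bs. length bs \<noteq> 2 \<Longrightarrow> F bs = 0"
  shows "F = binary f"
proof
  fix bs
  show "F bs = binary f bs"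
    by (cases "length bs = 2") (auto simp: assms binary_other length_Suc_conv numeral_2_eq_2)
qed

lemma binary_eq_iff: "binary f = binary g \<longleftrightarrow> (\<forall>x y. f x y = g x y)"
proof
  assume eq: "binary f = binary g"
  show "\<forall>x y. f x y = g x y"
    using fun_cong[OF eq, of "[_, _]"] by simp
qed (auto simp: binary_def fun_eq_iff split: list.splits)

lemma binary_add: "binary f + binary g = binary (\<lambda>x y. f x y + g x y :: 'b::monoid_add)"
  by (rule binary_eqI) (auto simp: binary_other)

lemma binary_zero_iff:
  fixes f :: "'b \<Rightarrow> 'b \<Rightarrow> 'b::zero"
  shows "binary f = 0 \<longleftrightarrow> (\<forall>x y. f x y = 0)"
proof -
  have "(0 :: 'b list \<Rightarrow> 'b) = binary (\<lambda>_ _. 0)"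
    by (rule binary_eqI) auto
  then have "binary f = 0 \<longleftrightarrow> binary f = binary (\<lambda>_ _. 0)"
    by (rule arg_cong)
  then show ?thesis unfolding binary_eq_iff .
qed

lemma scale_fun_binary:
  assumes "s c 0 = 0"
  shows "scale_fun s c (binary f) = binary (\<lambda>x y. s c (f x y))"
  by (rule binary_eqI) (auto simp: scale_fun_def binary_other assms)

lemma null_on_zero_binary:
  assumes "\<And>y. f 0 y = 0" "\<And>x. f x 0 = 0"
  shows "null_on_zero (binary f)"
  using assms by (auto simp: null_on_zero_def binary_def split: list.splits)

lemma binary_in_Hom_tensor:
  assumes f: "bilinear_map s s s f" and s: "module s"
  shows "binary f \<in> Hom_tensor s 2"
proof -
  have "module_hom s s (\<lambda>b. binary f (bs[i := b]))" if "length bs = 2" "i < 2" for bs i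
  proof -
    from that obtain x y where "bs = [x, y]"
      by (auto simp: length_Suc_conv numeral_2_eq_2)
    with that f show ?thesis
      by (cases i) (auto simp: bilinear_map_def)
  qed
  then show ?thesis by (simp add: Hom_tensor_def binary_other)
qed

text \<open>The Gerstenhaber bracket of \<open>f\<close> with the unary \<open>P\<close>: all signs
  in the circle products are trivial, since one arity is 1.\<close>

definition binary_deriv :: "('b \<Rightarrow> 'b) \<Rightarrow> ('b \<Rightarrow> 'b \<Rightarrow> 'b) \<Rightarrow> 'b \<Rightarrow> 'b \<Rightarrow> 'b::ab_group_add" where
  "binary_deriv P f x y = f (P x) y + f x (P y) - P (f x y)"

lemma pi_deriv_binary:
  assumes "P 0 = 0"
  shows "pi_deriv P (binary f) = binary (binary_deriv P f)"
  \<comment> \<open>On lists of any other length every term is 0 or \<open>P 0\<close>, so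
    \<open>P 0 = 0\<close> is what makes both sides vanish there.\<close>
  by (rule binary_eqI)
    (auto simp: pi_deriv_def binary_deriv_def binary_other assms lessThan_Suc numeral_2_eq_2)

section \<open>Iterated brackets with a square-zero map\<close>

locale square_zero_biadditive =
  fixes P :: "'b::ab_group_add \<Rightarrow> 'b" and f :: "'b \<Rightarrow> 'b \<Rightarrow> 'b"
  assumes P_add: "P (x + y) = P x + P y"
    and P_P: "P (P x) = 0"
    and f_add_left: "f (x + x') y = f x y + f x' y"
    and f_add_right: "f x (y + y') = f x y + f x y'"
begin

lemma zero [simp]: "P 0 = 0" "f 0 y = 0" "f x 0 = 0"
  using P_add[of 0 0] f_add_left[of 0 0 y] f_add_right[of x 0 0] by simp_all

lemma P_diff: "P (x - y) = P x - P y"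
  by (metis P_add add_diff_cancel_right' diff_add_cancel)

lemma P_minus: "P (- x) = - P x"
  using P_diff[of 0 x] by simp

text \<open>There are three places for \<open>P\<close>: two arguments and, with a minus sign, the
  value. Using a place twice gives 0, and each pair of places arises in two orders. The sum
  \<open>v + v\<close> stands for \<open>2 v\<close>, as no scalars act here.\<close>

lemma binary_deriv_2:
  "binary_deriv P (binary_deriv P f) x y =
     (f (P x) (P y) - P (f (P x) y) - P (f x (P y)))
     + (f (P x) (P y) - P (f (P x) y) - P (f x (P y)))"
  by (simp add: binary_deriv_def P_add P_diff P_P algebra_simps)

text \<open>All three places are now filled, in any of 3! = 6 orders; the value contributes the
  sign.\<close>

lemma binary_deriv_3:
  "binary_deriv P (binary_deriv P (binary_deriv P f)) x y =
     - (P (f (P x) (P y)) + P (f (P x) (P y)) + P (f (P x) (P y))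
      + P (f (P x) (P y)) + P (f (P x) (P y)) + P (f (P x) (P y)))"
  unfolding binary_deriv_def[of P "binary_deriv P (binary_deriv P f)"] binary_deriv_2
  by (simp add: P_add P_diff P_P algebra_simps)

text \<open>A fourth insertion must repeat one of the three places.\<close>

lemma binary_deriv_4:
  "binary_deriv P (binary_deriv P (binary_deriv P (binary_deriv P f))) x y = 0"
  unfolding binary_deriv_def[of P "binary_deriv P (binary_deriv P (binary_deriv P f))"]
    binary_deriv_3
  by (simp add: P_diff P_minus P_P)

lemma binary_deriv_ge_4:
  assumes "n \<ge> 4"
  shows "(binary_deriv P ^^ n) f x y = 0"
  using assms
proof (induction n arbitrary: x y rule: dec_induct)
  case base
  show ?case by (simp add: numeral_eq_Suc binary_deriv_4)
next
  case (step n)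
  then show ?case by (simp add: binary_deriv_def)
qed

text \<open>Sorted by the number of insertions of \<open>P\<close>, the summands are the iterated
  derivatives of orders 0 to 3, each divided by the factorial of its order. This is the exponential
  series without division.\<close>

lemma conjugate_expand:
  "f (x + P x) (y + P y) - P (f (x + P x) (y + P y)) =
     f x y + binary_deriv P f x y
     + (f (P x) (P y) - P (f (P x) y) - P (f x (P y))) - P (f (P x) (P y))"
  by (simp add: binary_deriv_def f_add_left f_add_right P_add algebra_simps)

end

section \<open>The exponential as a conjugation\<close>

text \<open>Scaling a repeated sum gives a sum of equal scalars \<open>\<iota> (1/2)\<close> or
  \<open>\<iota> (1/6)\<close>; additivity of \<open>\<iota>\<close> collects them into
  \<open>\<iota> 1 = 1\<close>.\<close>

lemma rat_inclusion_cancel: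
  assumes \<iota>: "rat_inclusion \<iota>" and s: "module s"
  shows "s (\<iota> 1) v = v" "s (\<iota> (1/2)) (v + v) = v"
    "s (\<iota> (1/6)) (v + v + v + v + v + v) = v"
proof -
  interpret module s by (rule s)
  have one: "\<iota> 1 = 1" and add: "\<And>x y. \<iota> (x + y) = \<iota> x + \<iota> y"
    using \<iota> by (auto simp: rat_inclusion_def)
  show "s (\<iota> 1) v = v" by (simp add: one)
  show "s (\<iota> (1/2)) (v + v) = v"
    unfolding scale_right_distrib scale_left_distrib[symmetric] add[symmetric] by (simp add: one)
  show "s (\<iota> (1/6)) (v + v + v + v + v + v) = v"
    unfolding scale_right_distrib scale_left_distrib[symmetric] add[symmetric] by (simp add: one)
qed

text \<open>The endomorphism underlying \<open>hat_pi\<close>. It reads only the bimodule component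
  and returns a pair in which that component is 0, hence squares to zero.\<close>

definition lift_operator :: "('m \<Rightarrow> 'a) \<Rightarrow> 'a \<times> 'm \<Rightarrow> 'a \<times> 'm::zero" where
  "lift_operator \<pi> x = (\<pi> (snd x), 0)"

lemma hat_pi_singleton: "hat_pi \<pi> [x] = lift_operator \<pi> x"
  by (cases x) (simp add: hat_pi_def lift_operator_def)

lemma hat_pi_other: "length bs \<noteq> 1 \<Longrightarrow> hat_pi \<pi> bs = 0"
  by (auto simp: hat_pi_def split: list.splits)

lemma gbracket_hat_pi_binary:
  assumes "square_zero_biadditive (lift_operator \<pi>) f"
  shows "gbracket (binary f) (hat_pi \<pi>) = binary (binary_deriv (lift_operator \<pi>) f)"
proof -
  interpret square_zero_biadditive "lift_operator \<pi>" f by (rule assms)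
  have "gbracket (binary f) (hat_pi \<pi>) = pi_deriv (lift_operator \<pi>) (binary f)"
    by (rule gbracket_unary)
      (auto simp: null_on_zero_binary hat_pi_singleton hat_pi_other)
  then show ?thesis by (simp add: pi_deriv_binary)
qed

lemma ham_power_binary:
  assumes "square_zero_biadditive (lift_operator \<pi>) f"
  shows "(ham \<pi> ^^ n) (binary f) = binary ((binary_deriv (lift_operator \<pi>) ^^ n) f)"
proof -
  interpret square_zero_biadditive "lift_operator \<pi>" f by (rule assms)
  have "((\<lambda>F. gbracket F (hat_pi \<pi>)) ^^ n) (binary f) = (pi_deriv (lift_operator \<pi>) ^^ n) (binary f)"
    using gbracket_powers[of "binary f" "lift_operator \<pi>" "hat_pi \<pi>" n]
    by (simp add: null_on_zero_binary hat_pi_singleton hat_pi_other)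
  moreover have "(pi_deriv (lift_operator \<pi>) ^^ n) (binary f)
      = binary ((binary_deriv (lift_operator \<pi>) ^^ n) f)"
    by (induction n) (simp_all add: pi_deriv_binary)
  moreover have "ham \<pi> = (\<lambda>F. gbracket F (hat_pi \<pi>))"
    by (rule ext) (simp add: ham_def)
  ultimately show ?thesis by simp
qed

lemma exp_ham_binary:
  assumes \<iota>: "rat_inclusion \<iota>" and s: "module s"
    and f: "square_zero_biadditive (lift_operator \<pi>) f"
  shows "exp_ham \<iota> s \<pi> (binary f) =
    binary (\<lambda>x y. f (x + lift_operator \<pi> x) (y + lift_operator \<pi> y)
      - lift_operator \<pi> (f (x + lift_operator \<pi> x) (y + lift_operator \<pi> y)))"
proof -
  let ?P = "lift_operator \<pi>"
  interpret square_zero_biadditive ?P f by (rule f)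
  interpret s: module s by (rule s)
  let ?D = "\<lambda>n. (ham \<pi> ^^ n) (binary f)"
  let ?t = "\<lambda>n. scale_fun s (\<iota> (1 / fact n)) (?D n)"
  note D = ham_power_binary[OF f]
  have van: "?D n = 0" if "n \<ge> 4" for n
    by (simp add: D binary_zero_iff binary_deriv_ge_4[OF that])
  have four: "4 = Suc (Suc (Suc (Suc 0)))"
    by simp
  \<comment> \<open>The sum over the nonzero iterates is extended to all orders below 4; the added
    terms are scaled zeros.\<close>
  have "exp_ham \<iota> s \<pi> (binary f) = sum ?t {..<4}"
    unfolding exp_ham_def
  proof (rule sum.mono_neutral_left)
    show "{n. ?D n \<noteq> 0} \<subseteq> {..<4}" using van by (auto simp: not_le[symmetric])
  qed (auto simp: scale_fun_def)
  also have "\<dots> = binary (\<lambda>x y. s (\<iota> 1) (f x y) + s (\<iota> 1) (binary_deriv ?P f x y)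
      + s (\<iota> (1/2)) (binary_deriv ?P (binary_deriv ?P f) x y)
      + s (\<iota> (1/6)) (binary_deriv ?P (binary_deriv ?P (binary_deriv ?P f)) x y))"
    unfolding D four sum.lessThan_Suc
    by (simp add: scale_fun_binary binary_add fact_numeral)
  \<comment> \<open>The coefficients 1/2 and 1/6 cancel the two and six equal copies in the second
    and third derivatives.\<close>
  also have "\<dots> = binary (\<lambda>x y. f (x + ?P x) (y + ?P y) - ?P (f (x + ?P x) (y + ?P y)))"
    by (simp only: binary_deriv_2 binary_deriv_3 s.scale_minus_right
        rat_inclusion_cancel[OF \<iota> s] conjugate_expand add_uminus_conv_diff)
  finally show ?thesis .
qed

section \<open>The twisted Rota-Baxter identity\<close>

text \<open>The multiplication of the extension of the algebra by the bimodule that belongs to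
  \<phi>; for \<phi> = 0 it is the semidirect product.\<close>

definition twisted_product ::
  "('a \<Rightarrow> 'm \<Rightarrow> 'm) \<Rightarrow> ('m \<Rightarrow> 'a \<Rightarrow> 'm) \<Rightarrow> ('a \<Rightarrow> 'a \<Rightarrow> 'm) \<Rightarrow>
   'a::ring \<times> 'm::ab_group_add \<Rightarrow> 'a \<times> 'm \<Rightarrow> 'a \<times> 'm" where
  "twisted_product lact ract \<phi> x y =
     (fst x * fst y, lact (fst x) (snd y) + ract (snd x) (fst y) + \<phi> (fst x) (fst y))"

lemma hat_mu_plus_hat_phi:
  "hat_mu lact ract + hat_phi \<phi> = binary (twisted_product lact ract \<phi>)"
  by (rule binary_eqI)
    (auto simp: hat_mu_def hat_phi_def twisted_product_def split: list.splits prod.splits)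

lemma hat_phi_eq_binary: "hat_phi \<phi> = binary (\<lambda>x y. (0, \<phi> (fst x) (fst y)))"
  by (rule binary_eqI) (auto simp: hat_phi_def split: list.splits prod.splits)

lemma bilinear_mapD:
  assumes "bilinear_map s1 s2 s3 f"
  shows "f (x + x') y = f x y + f x' y" "f x (y + y') = f x y + f x y'"
    "f (s1 c x) y = s3 c (f x y)" "f x (s2 c y) = s3 c (f x y)"
  using assms by (auto simp: bilinear_map_def module_hom_iff)

locale twisted_data = algebra_bimodule sA sM lact ract
  for sA :: "'k::comm_ring_1 \<Rightarrow> 'a::ring \<Rightarrow> 'a"
    and sM :: "'k \<Rightarrow> 'm::ab_group_add \<Rightarrow> 'm" and lact ract +
  fixes \<phi> :: "'a \<Rightarrow> 'a \<Rightarrow> 'm" and \<pi> :: "'m \<Rightarrow> 'a"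
  assumes cocycle: "hochschild_2_cocycle sA sM lact ract \<phi>"
    and hom: "module_hom sM sA \<pi>"
begin

sublocale prod: module_prod sA sM
  by unfold_locales

abbreviation P where "P \<equiv> lift_operator \<pi>"

abbreviation product where "product \<equiv> twisted_product lact ract \<phi>"

abbreviation phi_product where "phi_product \<equiv> \<lambda>x y. (0 :: 'a, \<phi> (fst x) (fst y))"

definition conjugate_product where
  "conjugate_product x y = product (x + P x) (y + P y) - P (product (x + P x) (y + P y))"

text \<open>The bimodule component of the twisted product of the points \<open>(\<pi> m, m)\<close>
  and \<open>(\<pi> n, n)\<close> on the graph of \<pi>.\<close>

definition induced_product where
  "induced_product m n = lact (\<pi> m) n + ract m (\<pi> n) + \<phi> (\<pi> m) (\<pi> n)"

lemma phi_bilinear: "bilinear_map sA sA sM \<phi>"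
  using cocycle by (simp add: hochschild_2_cocycle_def)

lemma cocycle_identity: "\<phi> (a * b) c = lact a (\<phi> b c) + \<phi> a (b * c) - ract (\<phi> a b) c"
  using cocycle by (simp add: hochschild_2_cocycle_def algebra_simps)

lemmas pi_simps = module_hom.add[OF hom] module_hom.scale[OF hom] module_hom.zero[OF hom]
  module_hom.diff[OF hom]

lemmas bilinear_simps = bilinear_mapD[OF mult_bilinear] bilinear_mapD[OF lact_bilinear]
  bilinear_mapD[OF ract_bilinear] bilinear_mapD[OF phi_bilinear]

lemma bilinear_zero [simp]:
  "lact 0 m = 0" "lact a 0 = 0" "ract 0 a = 0" "ract m 0 = 0" "\<phi> 0 a = 0" "\<phi> a 0 = 0"
  using bilinear_mapD(1,2)[OF lact_bilinear, of 0 0] bilinear_mapD(1,2)[OF ract_bilinear, of 0 0]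
    bilinear_mapD(1,2)[OF phi_bilinear, of 0 0]
    bilinear_mapD(2)[OF lact_bilinear, of _ 0 0] bilinear_mapD(2)[OF ract_bilinear, of _ 0 0]
    bilinear_mapD(2)[OF phi_bilinear, of _ 0 0]
  by simp_all

lemma square_zero_product: "square_zero_biadditive P product"
  by unfold_locales
    (simp_all add: lift_operator_def twisted_product_def pi_simps bilinear_simps prod_eq_iff)

lemma square_zero_phi_product: "square_zero_biadditive P phi_product"
  by unfold_locales
    (simp_all add: lift_operator_def pi_simps bilinear_simps prod_eq_iff)

lemma exp_ham_eq_binary:
  assumes "rat_inclusion \<iota>"
  shows "exp_ham \<iota> prod.scale \<pi> (hat_mu lact ract + hat_phi \<phi>) = binary conjugate_product"
  unfolding hat_mu_plus_hat_phi exp_ham_binary[OF assms prod.p.module_axioms square_zero_product]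
  by (simp add: conjugate_product_def[abs_def])

lemma truncation_eq_binary:
  assumes "rat_inclusion \<iota>"
  shows "hat_mu lact ract + hat_phi \<phi>
      + gbracket (hat_mu lact ract + hat_phi \<phi>) (hat_pi \<pi>)
      + scale_fun prod.scale (\<iota> (1 / 2)) (gbracket (gbracket (hat_phi \<phi>) (hat_pi \<pi>)) (hat_pi \<pi>))
    = binary (\<lambda>x y. product x y + binary_deriv P product x y
      + (phi_product (P x) (P y) - P (phi_product (P x) y) - P (phi_product x (P y))))"
proof -
  interpret phi: square_zero_biadditive P phi_product by (rule square_zero_phi_product)
  have "gbracket (gbracket (hat_phi \<phi>) (hat_pi \<pi>)) (hat_pi \<pi>)
      = binary (binary_deriv P (binary_deriv P phi_product))"
    using ham_power_binary[OF square_zero_phi_product, of 2]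
    by (simp add: ham_def numeral_2_eq_2 hat_phi_eq_binary)
  then show ?thesis
    unfolding hat_mu_plus_hat_phi
    by (simp only: gbracket_hat_pi_binary[OF square_zero_product] phi.binary_deriv_2
        scale_fun_binary[of prod.scale, OF prod.p.scale_zero_right]
        rat_inclusion_cancel[OF assms prod.p.module_axioms] binary_add)
qed

text \<open>Orders 0 and 1 cancel, and so do the \<phi>-terms of order 2. The order 2 terms of
  \<open>hat_mu\<close> give the untwisted Rota-Baxter defect, and the order 3 term supplies the
  missing \<open>- \<pi> (\<phi> (\<pi> m) (\<pi> n))\<close>.\<close>

lemma conjugate_product_minus_truncation:
  "conjugate_product x y
     - (product x y + binary_deriv P product x y
       + (phi_product (P x) (P y) - P (phi_product (P x) y) - P (phi_product x (P y))))
   = (\<pi> (snd x) * \<pi> (snd y) - \<pi> (induced_product (snd x) (snd y)), 0)"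
proof -
  interpret square_zero_biadditive P product by (rule square_zero_product)
  show ?thesis
    unfolding conjugate_product_def conjugate_expand
    by (simp add: twisted_product_def lift_operator_def induced_product_def pi_simps
        prod_eq_iff algebra_simps)
qed

lemma phi_rota_baxter_iff:
  "phi_rota_baxter sA sM lact ract \<phi> \<pi> \<longleftrightarrow>
     (\<forall>m n. \<pi> m * \<pi> n = \<pi> (induced_product m n))"
  by (simp add: phi_rota_baxter_def hom induced_product_def pi_simps)

lemma rota_baxter_iff_truncation:
  assumes "rat_inclusion \<iota>"
  shows "phi_rota_baxter sA sM lact ract \<phi> \<pi> \<longleftrightarrow>
     exp_ham \<iota> prod.scale \<pi> (hat_mu lact ract + hat_phi \<phi>) =
      hat_mu lact ract + hat_phi \<phi>
      + gbracket (hat_mu lact ract + hat_phi \<phi>) (hat_pi \<pi>)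
      + scale_fun prod.scale (\<iota> (1 / 2)) (gbracket (gbracket (hat_phi \<phi>) (hat_pi \<pi>)) (hat_pi \<pi>))"
  unfolding truncation_eq_binary[OF assms] exp_ham_eq_binary[OF assms] binary_eq_iff
  \<comment> \<open>Fixing the left side to \<open>conjugate_product _ _\<close> turns only the
    operation identity into a vanishing difference and leaves other equations alone. Every pair of
    bimodule elements occurs as second components.\<close>
  unfolding right_minus_eq[symmetric, of "conjugate_product _ _"]
    conjugate_product_minus_truncation phi_rota_baxter_iff
  by (simp add: zero_prod_def)

section \<open>The induced product on the bimodule\<close>

lemma conjugate_product_bilinear: "bilinear_map prod.scale prod.scale prod.scale conjugate_product"
  by (simp add: bilinear_map_def module_hom_iff prod.p.module_axioms conjugate_product_def
      prod.scale_def twisted_product_def lift_operator_def pi_simps bilinear_simps prod_eq_iff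
      algebra_simps)

lemma induced_product_bilinear: "bilinear_map sM sM sM induced_product"
  by (simp add: bilinear_map_def module_hom_iff M.module_axioms induced_product_def
      pi_simps bilinear_simps M.scale_right_distrib add_ac)

text \<open>\<open>1 + P\<close> moves \<open>(0, m)\<close> to the graph point
  \<open>(\<pi> m, m)\<close>, and \<open>1 - P\<close> corrects the algebra component of the
  product. What remains there is the Rota-Baxter defect, so the bimodule is closed under the product
  exactly when \<pi> is a \<phi>-Rota-Baxter operator.\<close>

lemma conjugate_product_on_module:
  "conjugate_product (0, m) (0, n) =
     (\<pi> m * \<pi> n - \<pi> (induced_product m n), induced_product m n)"
  by (simp add: conjugate_product_def twisted_product_def lift_operator_def
      induced_product_def)

text \<open>The Rota-Baxter identity makes \<pi> multiplicative for the induced product. The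
  bimodule axioms then match the action terms, and the cocycle identity matches those containing
  \<phi>.\<close>

lemma induced_product_assoc:
  assumes "phi_rota_baxter sA sM lact ract \<phi> \<pi>"
  shows "induced_product (induced_product m n) p
    = induced_product m (induced_product n p)"
proof -
  have \<pi>: "\<pi> (induced_product m n) = \<pi> m * \<pi> n" for m n
    using assms by (simp add: phi_rota_baxter_iff)
  show ?thesis
    \<comment> \<open>Only the outer products are opened first, so that \<pi> still meets the inner
      ones folded and becomes a product in the algebra.\<close>
    unfolding induced_product_def[of "induced_product m n"]
      induced_product_def[of m "induced_product n p"] \<pi>
    unfolding induced_product_def
    by (simp add: bilinear_simps lact_mult ract_mult lact_ract cocycle_identity algebra_simps)
qed

lemma restrict_M_binary: "restrict_M (binary conjugate_product) = induced_product"
  by (intro ext) (simp add: restrict_M_def conjugate_product_on_module)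

lemma restricts_to_assoc_mult_conjugate_product:
  assumes rb: "phi_rota_baxter sA sM lact ract \<phi> \<pi>"
  shows "restricts_to_assoc_mult sA sM (binary conjugate_product)"
  using binary_in_Hom_tensor[OF conjugate_product_bilinear prod.p.module_axioms] rb
  by (simp add: restricts_to_assoc_mult_def restrict_M_binary induced_product_bilinear
      induced_product_assoc[OF rb] conjugate_product_on_module phi_rota_baxter_iff)

end

theorem corollary3p12:
  fixes \<iota> :: "rat \<Rightarrow> 'k::comm_ring_1"
    and sA :: "'k \<Rightarrow> 'a::ring \<Rightarrow> 'a"
    and sM :: "'k \<Rightarrow> 'm::ab_group_add \<Rightarrow> 'm"
    and lact :: "'a \<Rightarrow> 'm \<Rightarrow> 'm" and ract :: "'m \<Rightarrow> 'a \<Rightarrow> 'm"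
    and \<phi> :: "'a \<Rightarrow> 'a \<Rightarrow> 'm" and \<pi> :: "'m \<Rightarrow> 'a"
  assumes "rat_inclusion \<iota>"
    and "algebra_bimodule sA sM lact ract"
    and "hochschild_2_cocycle sA sM lact ract \<phi>"
    and "module_hom sM sA \<pi>"
  shows "(phi_rota_baxter sA sM lact ract \<phi> \<pi> \<longleftrightarrow>
           exp_ham \<iota> (module_prod.scale sA sM) \<pi> (hat_mu lact ract + hat_phi \<phi>) =
             hat_mu lact ract + hat_phi \<phi>
             + gbracket (hat_mu lact ract + hat_phi \<phi>) (hat_pi \<pi>)
             + scale_fun (module_prod.scale sA sM) (\<iota> (1 / 2))
                 (gbracket (gbracket (hat_phi \<phi>) (hat_pi \<pi>)) (hat_pi \<pi>)))
       \<and> (phi_rota_baxter sA sM lact ract \<phi> \<pi> \<longrightarrow>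
           restricts_to_assoc_mult sA sM
             (exp_ham \<iota> (module_prod.scale sA sM) \<pi> (hat_mu lact ract + hat_phi \<phi>)) \<and>
           (\<forall>m n. restrict_M
               (exp_ham \<iota> (module_prod.scale sA sM) \<pi> (hat_mu lact ract + hat_phi \<phi>)) m n =
             lact (\<pi> m) n + ract m (\<pi> n) + \<phi> (\<pi> m) (\<pi> n)))"
proof -
  interpret twisted_data sA sM lact ract \<phi> \<pi>
    by (intro twisted_data.intro twisted_data_axioms.intro assms)
  note E = exp_ham_eq_binary[OF assms(1)]
  show ?thesis
    using rota_baxter_iff_truncation[OF assms(1)] restricts_to_assoc_mult_conjugate_product
    unfolding E restrict_M_binary induced_product_def
    by blast
qed

end
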